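(* Let $G$ be a finite group. (a) The homomorphism $\zeta_G$ is surjective and $\bar{\zeta}_G\colon G/O(G)\to \mathrm{Hom}(G^*,\mathbb{K}^\times)$ is an isomorphism. (b) The subgroup $O(G)$ is the smallest subgroup $[G,G]\le M\le G$ such that $A$ has an element of order $\exp(G/M)$. (c) For any normal subgroup $N$ of $G$ one has $O(G/N)=O(G)N/N$.
   Context: $\mathbb{K}$ is a field of characteristic $0$ and $A$ is a subgroup of the unit group $\mathbb{K}^\times$. For a finite group $G$, $G^*:=\mathrm{Hom}(G,A)$ (pointwise multiplication), $\exp(G)$ is the exponent of $G$ and $[G,G]$ its commutator subgroup. The homomorphism $\zeta_G\colon G\to\mathrm{Hom}(G^*,\mathbb{K}^\times)$ is $g\mapsto\varepsilon_g$ with $\varepsilon_g(\phi):=\phi(g)$ for $\phi\in G^*$. Set $O(G):=\ker(\zeta_G)=\bigcap_{\phi\in G^*}\ker(\phi)$, a normal subgroup of $G$ containing $[G,G]$, and let $\bar\zeta_G\colon G/O(G)\to\mathrm{Hom}(G^*,\mathbb{K}^\times)$ be the injective homomorphism induced by $\zeta_G$. *)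

theory Defs
  imports "HOL-Algebra.Algebra"
begin

text \<open>
  The pointwise group \<open>Hom(G, H)\<close>. The library's \<^const>\<open>hom\<close> does not constrain functions outside
  the carrier of \<open>G\<close>; restricting to extensional functions makes each homomorphism a single element.
\<close>

definition hom_group :: "('a, 'c) monoid_scheme \<Rightarrow> ('b, 'd) monoid_scheme \<Rightarrow> ('a \<Rightarrow> 'b) monoid"
  where "hom_group G H =
    \<lparr>carrier = hom G H \<inter> extensional (carrier G),
     monoid.mult = (\<lambda>f g. \<lambda>x\<in>carrier G. f x \<otimes>\<^bsub>H\<^esub> g x),
     one = (\<lambda>x\<in>carrier G. \<one>\<^bsub>H\<^esub>)\<rparr>"

definition dual_group ::
    "('k, 'r) ring_scheme \<Rightarrow> 'k set \<Rightarrow> ('a, 'b) monoid_scheme \<Rightarrow> ('a \<Rightarrow> 'k) monoid"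
  where "dual_group K A G = hom_group G (units_of K \<lparr>carrier := A\<rparr>)"

definition bidual_group ::
    "('k, 'r) ring_scheme \<Rightarrow> 'k set \<Rightarrow> ('a, 'b) monoid_scheme \<Rightarrow> (('a \<Rightarrow> 'k) \<Rightarrow> 'k) monoid"
  where "bidual_group K A G = hom_group (dual_group K A G) (units_of K)"

definition zeta ::
    "('k, 'r) ring_scheme \<Rightarrow> 'k set \<Rightarrow> ('a, 'b) monoid_scheme \<Rightarrow> 'a \<Rightarrow> ('a \<Rightarrow> 'k) \<Rightarrow> 'k"
  where "zeta K A G = (\<lambda>g. \<lambda>\<phi>\<in>carrier (dual_group K A G). \<phi> g)"

definition O_subgroup :: "('k, 'r) ring_scheme \<Rightarrow> 'k set \<Rightarrow> ('a, 'b) monoid_scheme \<Rightarrow> 'a set"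
  where "O_subgroup K A G = kernel G (bidual_group K A G) (zeta K A G)"

text \<open>
  The map induced by \<^const>\<open>zeta\<close> on cosets, in the form used by the library for the first
  isomorphism theorem: it takes a coset to the common value of \<^const>\<open>zeta\<close> on that coset.
\<close>

definition zeta_bar ::
    "('k, 'r) ring_scheme \<Rightarrow> 'k set \<Rightarrow> ('a, 'b) monoid_scheme \<Rightarrow> 'a set \<Rightarrow> ('a \<Rightarrow> 'k) \<Rightarrow> 'k"
  where "zeta_bar K A G = (\<lambda>C. the_elem (zeta K A G ` C))"

text \<open>Only meaningful for groups of finite exponent, in particular for finite groups.\<close>

definition group_exponent :: "('a, 'b) monoid_scheme \<Rightarrow> nat"
  where "group_exponent G = (LEAST n. 0 < n \<and> (\<forall>x\<in>carrier G. x [^]\<^bsub>G\<^esub> n = \<one>\<^bsub>G\<^esub>))"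

lemma comm_group_hom_group:
  assumes "group G" "comm_group H"
  shows "comm_group (hom_group G H)"
proof -
  interpret G: group G by fact
  interpret H: comm_group H by fact
  have inH: "f x \<in> carrier H" if "f \<in> hom G H" "x \<in> carrier G" for f x
    using that by (auto simp: hom_def)
  show ?thesis
  proof (rule comm_groupI)
    fix f g assume "f \<in> carrier (hom_group G H)" "g \<in> carrier (hom_group G H)"
    then show "f \<otimes>\<^bsub>hom_group G H\<^esub> g \<in> carrier (hom_group G H)"
      by (auto simp: hom_group_def hom_def Pi_iff H.m_ac)
  next
    show "\<one>\<^bsub>hom_group G H\<^esub> \<in> carrier (hom_group G H)"
      by (auto simp: hom_group_def hom_def)
  next
    fix f g h
    assume "f \<in> carrier (hom_group G H)" "g \<in> carrier (hom_group G H)" "h \<in> carrier (hom_group G H)"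
    then show "f \<otimes>\<^bsub>hom_group G H\<^esub> g \<otimes>\<^bsub>hom_group G H\<^esub> h = f \<otimes>\<^bsub>hom_group G H\<^esub> (g \<otimes>\<^bsub>hom_group G H\<^esub> h)"
      by (auto simp: hom_group_def fun_eq_iff inH H.m_assoc)
  next
    fix f g assume "f \<in> carrier (hom_group G H)" "g \<in> carrier (hom_group G H)"
    then show "f \<otimes>\<^bsub>hom_group G H\<^esub> g = g \<otimes>\<^bsub>hom_group G H\<^esub> f"
      by (auto simp: hom_group_def fun_eq_iff inH H.m_comm)
  next
    fix f assume "f \<in> carrier (hom_group G H)"
    then show "\<one>\<^bsub>hom_group G H\<^esub> \<otimes>\<^bsub>hom_group G H\<^esub> f = f"
      by (auto simp: hom_group_def fun_eq_iff inH extensional_def)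
  next
    fix f assume f: "f \<in> carrier (hom_group G H)"
    let ?g = "\<lambda>x\<in>carrier G. inv\<^bsub>H\<^esub> f x"
    have "?g \<in> carrier (hom_group G H)"
      using f by (auto simp: hom_group_def hom_def Pi_iff H.inv_mult)
    moreover have "?g \<otimes>\<^bsub>hom_group G H\<^esub> f = \<one>\<^bsub>hom_group G H\<^esub>"
      using f by (auto simp: hom_group_def fun_eq_iff inH)
    ultimately show "\<exists>g\<in>carrier (hom_group G H). g \<otimes>\<^bsub>hom_group G H\<^esub> f = \<one>\<^bsub>hom_group G H\<^esub>"
      by blast
  qed
qed

context
  fixes K :: "('k, 'r) ring_scheme" and A :: "'k set" and G :: "('a, 'b) monoid_scheme"
  assumes K: "field K" and A: "subgroup A (units_of K)" and G: "group G"
begin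

lemma comm_group_units: "comm_group (units_of K)"
proof -
  interpret field K by (rule K)
  show ?thesis by (rule units_comm_group)
qed

lemma comm_group_dual: "comm_group (dual_group K A G)"
proof -
  interpret U: comm_group "units_of K" by (rule comm_group_units)
  have "group (units_of K\<lparr>carrier := A\<rparr>)"
    by (rule U.subgroup_imp_group[OF A])
  then have "comm_group (units_of K\<lparr>carrier := A\<rparr>)"
    using subgroup.subset[OF A] by (intro group.group_comm_groupI) (auto simp: U.m_comm subset_iff)
  then show ?thesis
    unfolding dual_group_def by (intro comm_group_hom_group G)
qed

lemma comm_group_bidual: "comm_group (bidual_group K A G)"
  unfolding bidual_group_def
  by (intro comm_group_hom_group comm_group_units comm_group.axioms(2)[OF comm_group_dual])

lemma zeta_group_hom: "group_hom G (bidual_group K A G) (zeta K A G)"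
proof -
  interpret G: group G by (rule G)
  have sub: "A \<subseteq> carrier (units_of K)" using A by (rule subgroup.subset)
  interpret D: comm_group "dual_group K A G" by (rule comm_group_dual)
  have mult: "(\<phi> \<otimes>\<^bsub>dual_group K A G\<^esub> \<psi>) g = \<phi> g \<otimes>\<^bsub>units_of K\<^esub> \<psi> g"
    if "g \<in> carrier G" for \<phi> \<psi> g
    using that by (simp add: dual_group_def hom_group_def)
  have val: "\<phi> g \<in> carrier (units_of K)"
    if "\<phi> \<in> carrier (dual_group K A G)" "g \<in> carrier G" for \<phi> g
    using that sub by (auto simp: dual_group_def hom_group_def hom_def)
  have "zeta K A G g \<in> carrier (bidual_group K A G)" if "g \<in> carrier G" for g
    using that by (auto simp: zeta_def bidual_group_def hom_group_def hom_def mult val)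
  moreover have "zeta K A G (g \<otimes>\<^bsub>G\<^esub> h) = zeta K A G g \<otimes>\<^bsub>bidual_group K A G\<^esub> zeta K A G h"
    if "g \<in> carrier G" "h \<in> carrier G" for g h
    using that by (auto simp: zeta_def bidual_group_def dual_group_def hom_group_def hom_def fun_eq_iff)
  ultimately have "zeta K A G \<in> hom G (bidual_group K A G)"
    by (auto simp: hom_def)
  then show ?thesis
    by (intro group_hom.intro group_hom_axioms.intro G comm_group.axioms(2)[OF comm_group_bidual])
qed

lemma O_subgroup_eq_Inter:
  "O_subgroup K A G = (\<Inter>\<phi>\<in>carrier (dual_group K A G). kernel G (units_of K) \<phi>)"
proof -
  have "carrier (dual_group K A G) \<noteq> {}"
    using group.is_monoid[OF comm_group.axioms(2)[OF comm_group_dual]] monoid.one_closed by blast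
  then show ?thesis
    by (auto simp: O_subgroup_def kernel_def zeta_def bidual_group_def hom_group_def
        fun_eq_iff restrict_def)
qed

lemma zeta_bar_coset:
  assumes "g \<in> carrier G"
  shows "zeta_bar K A G (O_subgroup K A G #>\<^bsub>G\<^esub> g) = zeta K A G g"
proof -
  interpret group_hom G "bidual_group K A G" "zeta K A G" by (rule zeta_group_hom)
  have "zeta K A G ` (O_subgroup K A G #>\<^bsub>G\<^esub> g) = {zeta K A G g}"
    using assms by (force simp: O_subgroup_def kernel_def r_coset_def)
  then show ?thesis by (simp add: zeta_bar_def)
qed

end

end

theory Submission
  imports Defs
begin

text \<open>
  A character of \<open>G\<close> is a homomorphism from \<open>G\<close> to \<open>A\<close>; write \<open>G\<^sup>*\<close> for the group of characters.

  The surjectivity of \<open>\<zeta>\<close> is a matter of counting. In characteristic 0 the formula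
  \<open>|G\<^sup>*| \<cdot> |O(G)| = |G|\<close> holds for every finite group (\<open>card_dual_group\<close>): add up the character table
  by rows and by columns. A row is a character of \<open>G\<close> and a column is a character of \<open>G\<^sup>*\<close>, and the
  values of a nontrivial character sum to 0. Hence only the trivial character contributes to the sum
  by rows, which is therefore \<open>|G|\<close>, and only the elements of \<open>O(G)\<close> contribute to the sum by columns,
  which is therefore \<open>|G\<^sup>*| \<cdot> |O(G)|\<close>. The formula applies a second time, to the group \<open>G\<^sup>*\<close> and all
  units of the field. Evaluations at elements of \<open>G\<close> tell any two characters apart, so
  \<open>O(G\<^sup>*)\<close> is trivial there and the bidual has the same number of elements as \<open>G\<^sup>*\<close>, namely
  \<open>|G/O(G)|\<close>. An injective map between finite sets of equal size is bijective.

  For the minimality of \<open>O(G)\<close>, let \<open>G/M\<close> be abelian of exponent \<open>e\<close> and let \<open>A\<close> have an element \<open>a\<close> of order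
  \<open>e\<close>. The characters of \<open>G/M\<close> with values in the cyclic group generated by \<open>a\<close> already separate the points of
  \<open>G/M\<close>, because a character of a subgroup extends to the whole group: the root that has to be
  extracted to extend it by one more element exists among the powers of \<open>a\<close>
  (\<open>cyclic_characters_separate_points\<close>). So nothing outside \<open>M\<close> is killed by all characters. That \<open>O(G)\<close>
  itself satisfies the condition is seen on the group \<open>S\<close> of elements of \<open>A\<close> whose order divides
  \<open>e = exp(G/O(G))\<close>. It contains all values of characters and has an element \<open>a\<close> of order \<open>m\<close> with
  \<open>b\<^sup>m = 1\<close> for all \<open>b\<close> in \<open>S\<close>. Then all characters kill all \<open>m\<close>-th powers in \<open>G\<close>, which forces \<open>m = e\<close>.

  For quotients, \<open>O(G)N/N \<le> O(G/N)\<close> because characters of \<open>G/N\<close> are characters of \<open>G\<close>. Conversely,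
  \<open>G/O(G)N\<close> is a quotient of \<open>G/O(G)\<close>, so its exponent divides the order of an element of \<open>A\<close>; hence
  elements outside \<open>O(G)N\<close> are detected by characters that are trivial on \<open>N\<close>, and these factor
  through \<open>G/N\<close>.
\<close>

section \<open>Element orders in abelian groups\<close>

lemma (in comm_group) ord_mult_coprime:
  assumes x: "x \<in> carrier G" and y: "y \<in> carrier G" and cop: "coprime (ord x) (ord y)"
  shows "ord (x \<otimes> y) = ord x * ord y"
proof (rule dvd_antisym)
  show "ord (x \<otimes> y) dvd ord x * ord y"
    using x y by (rule abelian_ord_mul_divides)
  have dvd: "ord u dvd ord (u \<otimes> v)"
    if u: "u \<in> carrier G" and v: "v \<in> carrier G" and "coprime (ord u) (ord v)" for u v
  proof -
    let ?k = "ord (u \<otimes> v) * ord v"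
    have "v [^] ?k = \<one>" "(u \<otimes> v) [^] ?k = \<one>"
      using u v by (simp_all only: pow_eq_id m_closed dvd_triv_left dvd_triv_right)
    then have "u [^] ?k = \<one>"
      using u v by (simp add: pow_mult_distrib m_comm)
    then show ?thesis
      using u that(3) by (simp add: pow_eq_id coprime_dvd_mult_left_iff)
  qed
  show "ord x * ord y dvd ord (x \<otimes> y)"
    using dvd[OF x y cop] dvd[OF y x] cop
    by (metis coprime_commute divides_mult m_comm x y)
qed

text \<open>
  An element \<open>a\<close> of maximal order works: if the order of some \<open>b\<close> did not divide that of \<open>a\<close>, then some prime
  \<open>p\<close> would occur in it to a higher power, and replacing the \<open>p\<close>-part of \<open>a\<close> by that of \<open>b\<close> would
  increase the order.
\<close>

lemma (in comm_group) exists_ord_eq_exponent: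
  assumes S: "subgroup S G" and e: "0 < e" and kill: "\<And>b. b \<in> S \<Longrightarrow> b [^] (e::nat) = \<one>"
  shows "\<exists>a\<in>S. \<forall>b\<in>S. b [^] ord a = \<one>"
proof -
  have car: "b \<in> carrier G" if "b \<in> S" for b
    using S that by (rule subgroup.mem_carrier)
  have ord_dvd: "ord b dvd e" if "b \<in> S" for b
    using kill[OF that] car[OF that] by (simp add: pow_eq_id)
  have ord_pos: "0 < ord b" if "b \<in> S" for b
    using ord_dvd[OF that] e by (auto intro: dvd_pos_nat)
  have powS: "b [^] (n::nat) \<in> S" if "b \<in> S" for b n
    using S that by (induction n) (auto simp: subgroup.one_closed subgroup.m_closed)
  have "\<exists>a. a \<in> S \<and> (\<forall>b. b \<in> S \<longrightarrow> ord b \<le> ord a)"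
    using ex_has_greatest_nat[of "\<lambda>b. b \<in> S" \<one> ord "Suc e"] S e ord_dvd
    by (auto simp: subgroup.one_closed dest: dvd_imp_le intro: le_imp_less_Suc)
  then obtain a where a: "a \<in> S" and max: "\<And>b. b \<in> S \<Longrightarrow> ord b \<le> ord a" by blast
  have "ord b dvd ord a" if b: "b \<in> S" for b
  proof (rule ccontr)
    assume "\<not> ord b dvd ord a"
    then obtain p where p: "normalization_semidom_class.prime p" and mult: "multiplicity p (ord a) < multiplicity p (ord b)"
      using multiplicity_le_imp_dvd[of "ord b" "ord a"] ord_pos[OF b] by (metis not_le less_irrefl)
    define i where "i = multiplicity p (ord a)"
    define k where "k = multiplicity p (ord b)"
    (* a ^ (p ^ i) has order s, which is prime to p, and b ^ t has order p ^ k, so that their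
       product has order s * p ^ k, which exceeds ord a = s * p ^ i. *)
    obtain s where s: "ord a = p ^ i * s" "\<not> p dvd s"
      using multiplicity_decompose'[of "ord a" p] ord_pos[OF a] p unfolding i_def
      by (metis not_prime_unit nat_neq_iff)
    obtain t where t: "ord b = p ^ k * t" 
      using multiplicity_dvd[of p "ord b"] unfolding k_def by (auto elim: dvdE)
    have pos: "0 < s" "0 < t" "0 < p" using ord_pos[OF a] ord_pos[OF b] s t p by (auto simp: prime_gt_0_nat)
    have "ord (a [^] (p ^ i)) = s"
      using ord_pow[of a "p ^ i"] car[OF a] s pos by simp
    moreover have "ord (b [^] t) = p ^ k"
      using ord_pow[of b t] car[OF b] t pos by simp
    moreover have "coprime s (p ^ k)"
      using s(2) p by (metis coprime_commute coprime_power_right_iff prime_imp_coprime)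
    ultimately have "ord (a [^] (p ^ i) \<otimes> b [^] t) = s * p ^ k"
      using ord_mult_coprime[of "a [^] (p ^ i)" "b [^] t"] car[OF a] car[OF b] by simp
    moreover have "p ^ i < p ^ k"
      using mult p unfolding i_def k_def by (intro power_strict_increasing prime_gt_1_nat)
    ultimately have "ord a < ord (a [^] (p ^ i) \<otimes> b [^] t)"
      using s pos by simp
    moreover have "a [^] (p ^ i) \<otimes> b [^] t \<in> S"
      using S powS[OF a] powS[OF b] by (simp add: subgroup.m_closed)
    ultimately show False using max by fastforce
  qed
  then show ?thesis
    using a car by (auto simp: pow_eq_id)
qed

section \<open>Extension of homomorphisms between abelian groups\<close>

text \<open>
  On the subgroup generated by \<open>H\<close> and \<open>x\<close> the only candidate is \<open>h \<cdot> x\<^sup>i \<mapsto> \<chi>(h) \<cdot> d\<^sup>i\<close>. Integer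
  exponents keep the hypothesis \<open>compat\<close>, which says exactly that the candidate is well defined,
  symmetric in two representations of the same element.
\<close>

lemma extend_hom_by_element:
  fixes G (structure) and U
  assumes G: "comm_group G" and U: "comm_group U" and H: "subgroup H G"
    and \<chi>: "\<chi> \<in> hom (G\<lparr>carrier := H\<rparr>) U"
    and x: "x \<in> carrier G" and d: "d \<in> carrier U"
    and compat: "\<And>i::int. x [^] i \<in> H \<Longrightarrow> \<chi> (x [^] i) = d [^]\<^bsub>U\<^esub> i"
  obtains H' \<psi> where "subgroup H' G" "H \<subseteq> H'" "x \<in> H'"
    "\<psi> \<in> hom (G\<lparr>carrier := H'\<rparr>) U" "\<And>h. h \<in> H \<Longrightarrow> \<psi> h = \<chi> h" "\<psi> x = d"
proof -
  interpret G: comm_group G by (rule G)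
  interpret U: comm_group U by (rule U)
  interpret H: subgroup H G by (rule H)
  have \<chi>U [simp]: "\<chi> h \<in> carrier U" if "h \<in> H" for h
    using hom_in_carrier[OF \<chi>, of h] that by simp
  have \<chi>mult: "\<chi> (h \<otimes> h') = \<chi> h \<otimes>\<^bsub>U\<^esub> \<chi> h'" if "h \<in> H" "h' \<in> H" for h h'
    using hom_mult[OF \<chi>, of h h'] that by simp
  have \<chi>1: "\<chi> \<one> = \<one>\<^bsub>U\<^esub>"
    using compat[of 0] by simp
  note [simp] = x d
  have swap: "(h \<otimes> x [^] i) \<otimes> (h' \<otimes> x [^] j) = (h \<otimes> h') \<otimes> x [^] (i + j)"
    if "h \<in> H" "h' \<in> H" for h h' and i j :: int
    using that by (simp add: G.int_pow_mult G.m_ac)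
  have swapU: "(h \<otimes>\<^bsub>U\<^esub> d [^]\<^bsub>U\<^esub> i) \<otimes>\<^bsub>U\<^esub> (h' \<otimes>\<^bsub>U\<^esub> d [^]\<^bsub>U\<^esub> j)
      = (h \<otimes>\<^bsub>U\<^esub> h') \<otimes>\<^bsub>U\<^esub> d [^]\<^bsub>U\<^esub> (i + j)"
    if "h \<in> carrier U" "h' \<in> carrier U" for h h' and i j :: int
    using that by (simp add: U.int_pow_mult U.m_ac)
  have well_defined: "\<chi> h \<otimes>\<^bsub>U\<^esub> d [^]\<^bsub>U\<^esub> i = \<chi> h' \<otimes>\<^bsub>U\<^esub> d [^]\<^bsub>U\<^esub> j"
    if h: "h \<in> H" "h' \<in> H" and eq: "h \<otimes> x [^] i = h' \<otimes> x [^] j" for h h' and i j :: int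
  proof -
    have "h \<otimes> x [^] (i - j) = (h \<otimes> x [^] i) \<otimes> inv (x [^] j)"
      using h by (simp add: G.int_pow_diff G.m_assoc)
    also have "\<dots> = h'"
      using h by (simp add: eq G.m_assoc)
    finally have hx: "h \<otimes> x [^] (i - j) = h'" .
    then have "x [^] (i - j) = inv h \<otimes> h'"
      using h by (metis G.inv_solve_left G.int_pow_closed H.mem_carrier x)
    then have inH: "x [^] (i - j) \<in> H"
      using h by simp
    have "\<chi> h' = \<chi> h \<otimes>\<^bsub>U\<^esub> d [^]\<^bsub>U\<^esub> (i - j)"
      using \<chi>mult[OF h(1) inH] compat[OF inH] hx by simp
    then show ?thesis
      using h by (simp add: U.m_assoc flip: U.int_pow_mult)
  qed
  define H' where "H' = {h \<otimes> x [^] i | h i. h \<in> H \<and> i \<in> (UNIV :: int set)}"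
  define \<psi> where "\<psi> z = (THE u. \<exists>h\<in>H. \<exists>i::int. z = h \<otimes> x [^] i \<and> u = \<chi> h \<otimes>\<^bsub>U\<^esub> d [^]\<^bsub>U\<^esub> i)" for z
  have \<psi>: "\<psi> (h \<otimes> x [^] i) = \<chi> h \<otimes>\<^bsub>U\<^esub> d [^]\<^bsub>U\<^esub> i" if "h \<in> H" for h and i :: int
    unfolding \<psi>_def
  proof (rule the_equality)
    show "\<exists>h'\<in>H. \<exists>j::int. h \<otimes> x [^] i = h' \<otimes> x [^] j
        \<and> \<chi> h \<otimes>\<^bsub>U\<^esub> d [^]\<^bsub>U\<^esub> i = \<chi> h' \<otimes>\<^bsub>U\<^esub> d [^]\<^bsub>U\<^esub> j"
      using that by blast
    fix u
    assume "\<exists>h'\<in>H. \<exists>j::int. h \<otimes> x [^] i = h' \<otimes> x [^] j \<and> u = \<chi> h' \<otimes>\<^bsub>U\<^esub> d [^]\<^bsub>U\<^esub> j"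
    then show "u = \<chi> h \<otimes>\<^bsub>U\<^esub> d [^]\<^bsub>U\<^esub> i"
      by (elim bexE exE conjE) (simp only: well_defined[OF that])
  qed
  have memI: "h \<otimes> x [^] i \<in> H'" if "h \<in> H" for h and i :: int
    using that by (auto simp: H'_def)
  have memE: "\<exists>h\<in>H. \<exists>i::int. z = h \<otimes> x [^] i" if "z \<in> H'" for z
    using that by (auto simp: H'_def)
  show thesis
  proof
    show "subgroup H' G"
    proof (rule G.subgroupI)
      show "H' \<subseteq> carrier G" by (auto simp: H'_def)
      show "H' \<noteq> {}" using memI[OF H.one_closed] by blast
      fix z assume "z \<in> H'"
      then obtain h i where hi: "h \<in> H" "z = h \<otimes> x [^] (i::int)" using memE by blast
      then have "inv z = inv h \<otimes> x [^] (- i)"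
        by (simp add: G.inv_mult G.int_pow_neg)
      then show "inv z \<in> H'" using hi memI by simp
      fix w assume "w \<in> H'"
      then obtain h' j where "h' \<in> H" "w = h' \<otimes> x [^] (j::int)" using memE by blast
      then show "z \<otimes> w \<in> H'" using hi memI by (simp add: swap)
    qed
    show "H \<subseteq> H'" using memI[of _ 0] by (auto simp: subset_iff)
    show "x \<in> H'" using memI[of \<one> 1] by (simp add: G.int_pow_1)
    show "\<psi> \<in> hom (G\<lparr>carrier := H'\<rparr>) U"
    proof (rule homI)
      fix z assume "z \<in> carrier (G\<lparr>carrier := H'\<rparr>)"
      then obtain h i where hi: "h \<in> H" "z = h \<otimes> x [^] (i::int)" using memE[of z] by auto
      then show "\<psi> z \<in> carrier U" by (simp add: \<psi>)
      fix w assume "w \<in> carrier (G\<lparr>carrier := H'\<rparr>)"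
      then obtain h' j where "h' \<in> H" "w = h' \<otimes> x [^] (j::int)" using memE[of w] by auto
      then show "\<psi> (z \<otimes>\<^bsub>G\<lparr>carrier := H'\<rparr>\<^esub> w) = \<psi> z \<otimes>\<^bsub>U\<^esub> \<psi> w"
        using hi by (simp add: swap swapU \<psi> \<chi>mult)
    qed
    show "\<psi> h = \<chi> h" if "h \<in> H" for h
      using \<psi>[OF that, of 0] that by simp
    show "\<psi> x = d" using \<psi>[OF H.one_closed, of 1] \<chi>1 by (simp add: G.int_pow_1 U.int_pow_1)
  qed
qed

text \<open>
  A nontrivial value at \<open>g\<close> is easily had on the subgroup generated by \<open>g\<close>: map \<open>g\<close> to a power of \<open>a\<close>
  whose order is that of \<open>g\<close>. A largest subgroup \<open>H\<close> with a homomorphism that is nontrivial at \<open>g\<close> must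
  be everything: if \<open>x\<close> has order \<open>k\<close> modulo \<open>H\<close>, then extending the homomorphism to \<open>x\<close> amounts to
  extracting a \<open>k\<close>-th root of the value at \<open>x\<^sup>k\<close>. Such a root exists, since \<open>k\<close> divides \<open>e\<close> and the
  \<open>(e/k)\<close>-th power of that value is the value at \<open>x\<^sup>e = 1\<close>.
\<close>

lemma cyclic_characters_separate_points:
  fixes G (structure) and U
  assumes G: "comm_group G" and fin: "finite (carrier G)" and U: "comm_group U"
    and a: "a \<in> carrier U" and gen: "\<And>u. u \<in> carrier U \<Longrightarrow> \<exists>j::nat. u = a [^]\<^bsub>U\<^esub> j"
    and e: "group.ord U a = e" "0 < e"
    and kill: "\<And>x. x \<in> carrier G \<Longrightarrow> x [^] e = \<one>"
    and g: "g \<in> carrier G" "g \<noteq> \<one>"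
  shows "\<exists>\<chi>\<in>hom G U. \<chi> g \<noteq> \<one>\<^bsub>U\<^esub>"
proof -
  interpret G: comm_group G by (rule G)
  interpret U: comm_group U by (rule U)
  define F where "F = {H. subgroup H G \<and> g \<in> H \<and> (\<exists>\<chi>\<in>hom (G\<lparr>carrier := H\<rparr>) U. \<chi> g \<noteq> \<one>\<^bsub>U\<^esub>)}"
  have "\<exists>H. H \<in> F"
  proof -
    define k where "k = G.ord g"
    define d where "d = a [^]\<^bsub>U\<^esub> (e div k)"
    have k: "k dvd e" "k \<noteq> 1"
      using kill[OF g(1)] g G.ord_eq_1[of g] by (simp_all add: k_def G.pow_eq_id)
    have d: "d \<in> carrier U" using a by (simp add: d_def)
    have "\<not> e dvd e div k"
      using k e by (auto dest!: dvd_imp_le simp: dvd_def)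
    then have "d \<noteq> \<one>\<^bsub>U\<^esub>" using a e by (simp add: d_def U.pow_eq_id)
    have dk: "d [^]\<^bsub>U\<^esub> k = \<one>\<^bsub>U\<^esub>"
      using a e k by (simp add: d_def U.nat_pow_pow U.pow_eq_id)
    have "\<one>\<^bsub>U\<^esub> = d [^]\<^bsub>U\<^esub> i" if "g [^] i \<in> {\<one>}" for i :: int
    proof -
      have "int k dvd i" using that g by (simp add: G.int_pow_eq_id k_def)
      then have "int (U.ord d) dvd i"
        using dk d by (metis U.pow_eq_id dvd_trans int_dvd_int_iff)
      then show ?thesis using d by (metis U.int_pow_eq_id)
    qed
    moreover have "(\<lambda>_. \<one>\<^bsub>U\<^esub>) \<in> hom (G\<lparr>carrier := {\<one>}\<rparr>) U"
      by (simp add: hom_def)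
    ultimately obtain H \<psi> where "subgroup H G" "g \<in> H" "\<psi> \<in> hom (G\<lparr>carrier := H\<rparr>) U" "\<psi> g = d"
      using extend_hom_by_element[OF G U G.triv_subgroup _ g(1) d] by metis
    then show ?thesis using \<open>d \<noteq> \<one>\<^bsub>U\<^esub>\<close> by (auto simp: F_def)
  qed
  moreover have "card H < Suc (card (carrier G))" if "H \<in> F" for H
    using that fin by (auto simp: F_def less_Suc_eq_le intro: card_mono dest: subgroup.subset)
  ultimately obtain H where HF: "H \<in> F" and max: "\<And>H'. H' \<in> F \<Longrightarrow> card H' \<le> card H"
    using ex_has_greatest_nat[of "\<lambda>H. H \<in> F" _ card] by metis
  from HF obtain \<chi> where H: "subgroup H G" and gH: "g \<in> H"
    and \<chi>: "\<chi> \<in> hom (G\<lparr>carrier := H\<rparr>) U" and \<chi>g: "\<chi> g \<noteq> \<one>\<^bsub>U\<^esub>"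
    by (auto simp: F_def)
  interpret H: subgroup H G by (rule H)
  interpret N: normal H G by (simp add: G.normal_iff_subgroup H)
  interpret Q: group "G Mod H" by (rule N.factorgroup_is_group)
  interpret \<chi>: group_hom "G\<lparr>carrier := H\<rparr>" U \<chi>
    by (intro group_hom.intro group_hom_axioms.intro \<chi> U.is_group G.subgroup_imp_group H)
  have "H = carrier G"
  proof (rule ccontr)
    assume "H \<noteq> carrier G"
    then obtain x where x: "x \<in> carrier G" "x \<notin> H" using H.subset by blast
    define k where "k = Q.ord (H #> x)"
    have xQ: "H #> x \<in> carrier (G Mod H)" using x by (simp add: carrier_FactGroup)
    \<comment> \<open>\<open>H\<close> is normal, so the order of its coset of \<open>x\<close> describes the powers of \<open>x\<close> in \<open>H\<close>.\<close>
    have coset_iff: "x [^] i \<in> H \<longleftrightarrow> int k dvd i" for i :: int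
    proof -
      have "x [^] i \<in> H \<longleftrightarrow> H #> x [^] i = H"
        using x H by (metis G.coset_join1 G.coset_join2 G.int_pow_closed H.subset)
      also have "\<dots> \<longleftrightarrow> (H #> x) [^]\<^bsub>G Mod H\<^esub> i = \<one>\<^bsub>G Mod H\<^esub>"
        using x by (simp add: N.FactGroup_int_pow)
      finally show ?thesis using Q.int_pow_eq_id[OF xQ, of i] by (simp add: k_def)
    qed
    have xe: "x [^] int e = \<one>" using kill[OF x(1)] by (simp add: int_pow_int)
    have "k dvd e" using coset_iff[of "int e"] xe by simp
    then obtain l where l: "e = k * l" by (auto elim: dvdE)
    have xk: "x [^] k \<in> H" using coset_iff[of "int k"] by (simp add: int_pow_int)
    then obtain j where j: "\<chi> (x [^] k) = a [^]\<^bsub>U\<^esub> (j::nat)"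
      using gen[OF \<chi>.hom_closed[of "x [^] k"]] by auto
    have powH: "y [^]\<^bsub>G\<lparr>carrier := H\<rparr>\<^esub> (i::int) = y [^] i" if "y \<in> H" for y i
      using G.int_pow_consistent[OF H that] by simp
    have \<chi>pow: "\<chi> (y [^] i) = \<chi> y [^]\<^bsub>U\<^esub> i" if "y \<in> H" for y and i :: int
      using \<chi>.hom_int_pow[of y i] that by (simp add: powH)
    have "a [^]\<^bsub>U\<^esub> (j * l) = \<chi> ((x [^] k) [^] int l)"
      using \<chi>pow[OF xk, of "int l"] a j by (simp add: int_pow_int U.nat_pow_pow)
    also have "\<dots> = \<chi> \<one>"
      using x kill l by (simp add: int_pow_int G.nat_pow_pow)
    also have "\<dots> = \<one>\<^bsub>U\<^esub>" using \<chi>.hom_one by simp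
    finally have "k * l dvd j * l" using a e l by (simp add: U.pow_eq_id)
    \<comment> \<open>The value at \<open>x\<^sup>k\<close> is the \<open>k\<close>-th power of \<open>a\<^sup>m\<close>, the root to be extracted.\<close>
    then obtain m where m: "j = k * m" using e l by (auto elim: dvdE)
    define d where "d = a [^]\<^bsub>U\<^esub> m"
    have d: "d \<in> carrier U" using a by (simp add: d_def)
    have dk: "d [^]\<^bsub>U\<^esub> k = \<chi> (x [^] k)"
      using a j m by (simp add: d_def U.nat_pow_pow mult.commute)
    have compat: "\<chi> (x [^] i) = d [^]\<^bsub>U\<^esub> i" if "x [^] i \<in> H" for i :: int
    proof -
      have "int k dvd i" using that coset_iff[of i] by simp
      then obtain r where r: "i = int k * r" by (rule dvdE)
      have "\<chi> (x [^] i) = \<chi> ((x [^] k) [^] r)"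
        using x by (simp add: r G.int_pow_pow flip: int_pow_int)
      also have "\<dots> = (d [^]\<^bsub>U\<^esub> k) [^]\<^bsub>U\<^esub> r" using xk by (simp add: \<chi>pow dk)
      also have "\<dots> = d [^]\<^bsub>U\<^esub> i" using d by (simp add: r U.int_pow_pow flip: int_pow_int)
      finally show ?thesis .
    qed
    obtain H' \<psi> where H': "subgroup H' G" "H \<subseteq> H'" "x \<in> H'"
      "\<psi> \<in> hom (G\<lparr>carrier := H'\<rparr>) U" "\<And>h. h \<in> H \<Longrightarrow> \<psi> h = \<chi> h"
      using extend_hom_by_element[OF G U H \<chi> x(1) d compat] by metis
    then have "\<psi> g \<noteq> \<one>\<^bsub>U\<^esub>" using gH \<chi>g by simp
    then have "H' \<in> F" using gH H'(1,2,4) unfolding F_def by blast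
    moreover have "card H < card H'"
      using H' x fin by (intro psubset_card_mono) (auto intro: finite_subset dest: subgroup.subset)
    ultimately show False using max by fastforce
  qed
  then show ?thesis using \<chi> \<chi>g by auto
qed

section \<open>Counting characters\<close>

lemma (in domain) finite_roots_of_unity:
  assumes "0 < n"
  shows "finite {x \<in> carrier R. x [^] (n::nat) = \<one>}"
proof -
  \<comment> \<open>The list of coefficients of \<open>X\<^sup>n - 1\<close>, leading coefficient first.\<close>
  let ?p = "(\<one> # replicate (n - 1) \<zero>) @ [\<ominus> \<one>]"
  have "?p \<in> carrier (poly_ring R)"
    unfolding univ_poly_carrier[symmetric] polynomial_def by auto
  then have "finite {x. is_root ?p x}"
    by (rule finite_number_of_roots)
  moreover have "is_root ?p x" if x: "x \<in> carrier R" "x [^] n = \<one>" for x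
  proof -
    have "eval (\<one> # replicate (n - 1) \<zero>) x = x [^] (n - 1)"
      using eval_monom[of \<one> x "n - 1"] x by (simp add: monom_def)
    moreover have "x [^] (n - 1) \<otimes> x = x [^] n"
      using assms by (metis Suc_diff_1 nat_pow_Suc)
    moreover have "eval ?p x = eval (\<one> # replicate (n - 1) \<zero>) x \<otimes> x \<oplus> \<ominus> \<one>"
      using x(1) by (intro eval_append_aux) auto
    ultimately have "eval ?p x = x [^] n \<oplus> \<ominus> \<one>"
      by (simp only:)
    then show ?thesis
      using x by (simp add: is_root_def r_neg)
  qed
  ultimately show ?thesis
    by (auto elim: finite_subset[rotated])
qed

lemma (in comm_monoid) finprod_commute:
  assumes "finite A" "finite B" and f: "\<And>i j. \<lbrakk>i \<in> A; j \<in> B\<rbrakk> \<Longrightarrow> f i j \<in> carrier G"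
  shows "(\<Otimes>i\<in>A. \<Otimes>j\<in>B. f i j) = (\<Otimes>j\<in>B. \<Otimes>i\<in>A. f i j)"
  using assms(1) f
proof (induction A)
  case (insert a A)
  have "(\<Otimes>i\<in>insert a A. \<Otimes>j\<in>B. f i j) = (\<Otimes>j\<in>B. f a j) \<otimes> (\<Otimes>j\<in>B. \<Otimes>i\<in>A. f i j)"
    using insert by simp
  also have "\<dots> = (\<Otimes>j\<in>B. f a j \<otimes> (\<Otimes>i\<in>A. f i j))"
    using insert.prems by (intro finprod_multf[symmetric]) auto
  also have "\<dots> = (\<Otimes>j\<in>B. \<Otimes>i\<in>insert a A. f i j)"
    using insert by (intro finprod_cong') auto
  finally show ?case .
qed simp

text \<open>
  If \<open>\<chi>(h) \<noteq> 1\<close>, translation of the summation variable by \<open>h\<close> shows that the sum is unchanged under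
  multiplication by \<open>\<chi>(h)\<close>, so it vanishes.
\<close>

lemma (in field) sum_of_character:
  assumes H: "group H" and fin: "finite (carrier H)" and \<chi>: "\<chi> \<in> hom H (units_of R)"
  shows "(\<Oplus>h\<in>carrier H. \<chi> h)
    = (if \<forall>h\<in>carrier H. \<chi> h = \<one> then [card (carrier H)] \<cdot> \<one> else \<zero>)"
proof (cases "\<forall>h\<in>carrier H. \<chi> h = \<one>")
  case True
  then have "(\<Oplus>h\<in>carrier H. \<chi> h) = (\<Oplus>h\<in>carrier H. \<one>)"
    by (intro add.finprod_cong') auto
  then show ?thesis
    using True by (simp add: add.finprod_const)
next
  case False
  interpret H: group H by (rule H)
  from False obtain h where h: "h \<in> carrier H" "\<chi> h \<noteq> \<one>" by blast
  have \<chi>R: "\<chi> g \<in> carrier R" if "g \<in> carrier H" for g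
    using hom_in_carrier[OF \<chi> that] by (auto simp: units_of_def)
  have \<chi>mult: "\<chi> (g \<otimes>\<^bsub>H\<^esub> g') = \<chi> g \<otimes> \<chi> g'" if "g \<in> carrier H" "g' \<in> carrier H" for g g'
    using hom_mult[OF \<chi> that] by (simp add: units_of_def)
  let ?S = "\<Oplus>g\<in>carrier H. \<chi> g"
  have S: "?S \<in> carrier R" using \<chi>R by (intro finsum_closed) auto
  have "\<chi> h \<otimes> ?S = (\<Oplus>g\<in>carrier H. \<chi> h \<otimes> \<chi> g)"
    using fin \<chi>R h by (intro finsum_rdistr) auto
  also have "\<dots> = (\<Oplus>g\<in>carrier H. \<chi> (h \<otimes>\<^bsub>H\<^esub> g))"
    using \<chi>R h by (intro add.finprod_cong') (auto simp: \<chi>mult)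
  also have "\<dots> = (\<Oplus>g\<in>(\<lambda>g. h \<otimes>\<^bsub>H\<^esub> g) ` carrier H. \<chi> g)"
    using \<chi>R h by (intro add.finprod_reindex[symmetric]) (auto simp: inj_on_def)
  also have "(\<lambda>g. h \<otimes>\<^bsub>H\<^esub> g) ` carrier H = carrier H"
    using h by (metis H.surj_const_mult)
  finally have "(\<chi> h \<ominus> \<one>) \<otimes> ?S = \<zero>"
    using S \<chi>R h by (simp add: minus_eq l_distr l_minus r_neg)
  moreover have "\<chi> h \<ominus> \<one> \<noteq> \<zero>" "\<chi> h \<ominus> \<one> \<in> carrier R"
    using \<chi>R h by simp_all
  ultimately have "?S = \<zero>"
    using S integral by blast
  then show ?thesis unfolding if_not_P[OF False] .
qed

lemma (in field) dual_value:
  assumes "subgroup A (units_of R)" "\<phi> \<in> carrier (dual_group R A G)" "g \<in> carrier G"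
  shows "\<phi> g \<in> A" "\<phi> g \<in> Units R" "\<phi> g \<in> carrier R"
proof -
  show "\<phi> g \<in> A"
    using assms by (auto simp: dual_group_def hom_group_def hom_def)
  then show "\<phi> g \<in> Units R"
    using subgroup.subset[OF assms(1)] by (auto simp: units_of_def)
  then show "\<phi> g \<in> carrier R" by (rule Units_closed)
qed

lemma (in field) dual_hom_units:
  assumes A: "subgroup A (units_of R)" and \<phi>: "\<phi> \<in> carrier (dual_group R A G)"
  shows "\<phi> \<in> hom G (units_of R)"
  using dual_value(2)[OF A \<phi>] \<phi>
  by (auto simp: dual_group_def hom_group_def hom_def units_of_def)

lemma (in field) mem_O_subgroup_iff:
  assumes "subgroup A (units_of R)" "group G"
  shows "g \<in> O_subgroup R A G \<longleftrightarrow> g \<in> carrier G \<and> (\<forall>\<phi>\<in>carrier (dual_group R A G). \<phi> g = \<one>)"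
proof -
  have "\<exists>\<phi>. \<phi> \<in> carrier (dual_group R A G)"
    using comm_group_dual[OF field_axioms assms]
    by (meson comm_group.axioms(2) group.is_monoid monoid.one_closed)
  then show ?thesis
    by (auto simp: O_subgroup_eq_Inter[OF field_axioms assms] kernel_def units_of_def)
qed

text \<open>
  The values of characters are roots of \<open>X\<^sup>n - 1\<close> with \<open>n = |G|\<close>, and a field has finitely many of those.
\<close>

lemma (in field) finite_dual_group:
  assumes A: "subgroup A (units_of R)" and G: "group G" and fin: "finite (carrier G)"
  shows "finite (carrier (dual_group R A G))"
proof (rule finite_subset)
  interpret G: group G by (rule G)
  interpret U: comm_group "units_of R" by (rule units_comm_group)
  have pos: "0 < order G" using fin by (simp add: G.order_gt_0_iff_finite)
  show "finite (carrier G \<rightarrow>\<^sub>E {x \<in> carrier R. x [^] order G = \<one>})"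
    using fin finite_roots_of_unity[OF pos] by (rule finite_PiE)
  have "\<phi> g [^] order G = \<one>" if \<phi>: "\<phi> \<in> carrier (dual_group R A G)" and g: "g \<in> carrier G" for \<phi> g
  proof -
    interpret \<phi>: group_hom G "units_of R" \<phi>
      using dual_hom_units[OF A \<phi>] by unfold_locales
    have "\<phi> g [^] order G = \<phi> g [^]\<^bsub>units_of R\<^esub> order G"
      using dual_value[OF A \<phi> g] by (simp add: units_of_pow)
    also have "\<dots> = \<phi> (g [^]\<^bsub>G\<^esub> order G)"
      using g by (simp add: \<phi>.hom_nat_pow)
    finally show ?thesis
      using g by (simp add: G.pow_order_eq_1 units_of_one)
  qed
  then show "carrier (dual_group R A G) \<subseteq> carrier G \<rightarrow>\<^sub>E {x \<in> carrier R. x [^] order G = \<one>}"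
    using dual_value(3)[OF A] by (force simp: PiE_iff dual_group_def hom_group_def)
qed

text \<open>
  Both sides are the sum of all entries of the character table, an equation in the field that
  characteristic 0 turns into one of natural numbers.
\<close>

lemma (in field) card_dual_group:
  assumes char_0: "\<And>n::nat. 0 < n \<Longrightarrow> [n] \<cdot> \<one> \<noteq> \<zero>"
    and A: "subgroup A (units_of R)" and G: "group G" and fin: "finite (carrier G)"
  shows "card (carrier (dual_group R A G)) * card (O_subgroup R A G) = card (carrier G)"
proof -
  let ?D = "dual_group R A G" and ?O = "O_subgroup R A G"
  interpret D: comm_group ?D by (rule comm_group_dual[OF field_axioms A G])
  interpret Z: group_hom G "bidual_group R A G" "zeta R A G"
    by (rule zeta_group_hom[OF field_axioms A G])
  note finD = finite_dual_group[OF A G fin]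
  note val = dual_value[OF A]
  have O_sub: "?O \<subseteq> carrier G" by (auto simp: mem_O_subgroup_iff[OF A G])
  have one_D: "\<phi> = \<one>\<^bsub>?D\<^esub> \<longleftrightarrow> (\<forall>g\<in>carrier G. \<phi> g = \<one>)" if "\<phi> \<in> carrier ?D" for \<phi>
    using that by (auto simp: dual_group_def hom_group_def units_of_def extensional_def fun_eq_iff)
  have "(\<Oplus>\<phi>\<in>carrier ?D. \<Oplus>g\<in>carrier G. \<phi> g)
      = (\<Oplus>\<phi>\<in>carrier ?D. if \<phi> = \<one>\<^bsub>?D\<^esub> then [card (carrier G)] \<cdot> \<one> else \<zero>)"
    using sum_of_character[OF G fin dual_hom_units[OF A]]
    by (intro add.finprod_cong') (auto simp: one_D)
  also have "\<dots> = [card (carrier G)] \<cdot> \<one>"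
    using add.finprod_singleton_swap[of "\<one>\<^bsub>?D\<^esub>" "carrier ?D" "\<lambda>_. [card (carrier G)] \<cdot> \<one>"] finD
    by simp
  finally have by_rows: "(\<Oplus>\<phi>\<in>carrier ?D. \<Oplus>g\<in>carrier G. \<phi> g) = [card (carrier G)] \<cdot> \<one>" .
  have column: "(\<Oplus>\<phi>\<in>carrier ?D. \<phi> g) = (if g \<in> ?O then [card (carrier ?D)] \<cdot> \<one> else \<zero>)"
    if g: "g \<in> carrier G" for g
  proof -
    \<comment> \<open>Evaluation at \<open>g\<close> is a character of the dual group, trivial exactly if \<open>g\<close> lies in \<open>O(G)\<close>.\<close>
    have "zeta R A G g \<in> hom ?D (units_of R)"
      using Z.hom_closed[OF g] by (simp add: bidual_group_def hom_group_def)
    then have "(\<Oplus>\<phi>\<in>carrier ?D. zeta R A G g \<phi>) = (if g \<in> ?O then [card (carrier ?D)] \<cdot> \<one> else \<zero>)"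
      using sum_of_character[OF D.is_group finD, of "zeta R A G g"] g
      by (auto simp: mem_O_subgroup_iff[OF A G] zeta_def)
    moreover have "(\<Oplus>\<phi>\<in>carrier ?D. zeta R A G g \<phi>) = (\<Oplus>\<phi>\<in>carrier ?D. \<phi> g)"
      using val g by (intro add.finprod_cong') (auto simp: zeta_def)
    ultimately show ?thesis by simp
  qed
  have "(\<Oplus>\<phi>\<in>carrier ?D. \<Oplus>g\<in>carrier G. \<phi> g) = (\<Oplus>g\<in>carrier G. \<Oplus>\<phi>\<in>carrier ?D. \<phi> g)"
    using fin finD val by (intro add.finprod_commute) auto
  also have "\<dots> = (\<Oplus>g\<in>carrier G. if g \<in> ?O then [card (carrier ?D)] \<cdot> \<one> else \<zero>)"
    by (intro add.finprod_cong') (auto simp: column)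
  also have "\<dots> = (\<Oplus>g\<in>?O. [card (carrier ?D)] \<cdot> \<one>)"
    using fin O_sub by (intro add.finprod_mono_neutral_cong_right) auto
  also have "\<dots> = [(card (carrier ?D) * card ?O)] \<cdot> \<one>"
    by (simp add: add.finprod_const add.nat_pow_pow)
  finally have eq: "[(card (carrier ?D) * card ?O)] \<cdot> \<one> = [card (carrier G)] \<cdot> \<one>"
    using by_rows by simp
  have inj: "\<not> m < n" if "[m] \<cdot> \<one> = [n] \<cdot> \<one>" for m n :: nat
  proof
    assume "m < n"
    then have "[m] \<cdot> \<one> \<oplus> [(n - m)] \<cdot> \<one> = [n] \<cdot> \<one>"
      using add.nat_pow_mult[of \<one> m "n - m"] by simp
    then have "[m] \<cdot> \<one> \<oplus> [(n - m)] \<cdot> \<one> = [m] \<cdot> \<one> \<oplus> \<zero>"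
      using that[symmetric] by simp
    then have "[(n - m)] \<cdot> \<one> = \<zero>"
      by (simp only: add.l_cancel add.nat_pow_closed one_closed zero_closed)
    then show False using char_0[of "n - m"] \<open>m < n\<close> by simp
  qed
  show ?thesis using inj[OF eq] inj[OF eq[symmetric]] by linarith
qed

text \<open>
  The bidual is the dual of \<open>G\<^sup>*\<close> formed with all units of the field, so \<open>card_dual_group\<close> applied to
  \<open>G\<close> and to \<open>G\<^sup>*\<close> shows that it has as many elements as \<open>G/O(G)\<close>.
\<close>

lemma (in field) zeta_bijective:
  assumes char_0: "\<And>n::nat. 0 < n \<Longrightarrow> [n] \<cdot> \<one> \<noteq> \<zero>"
    and A: "subgroup A (units_of R)" and G: "group G" and fin: "finite (carrier G)"
  shows "zeta R A G \<in> epi G (bidual_group R A G)"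
    and "zeta_bar R A G \<in> iso (G Mod O_subgroup R A G) (bidual_group R A G)"
proof -
  let ?D = "dual_group R A G" and ?B = "bidual_group R A G" and ?O = "O_subgroup R A G"
  interpret Z: group_hom G ?B "zeta R A G"
    by (rule zeta_group_hom[OF field_axioms A G])
  interpret U: comm_group "units_of R" by (rule units_comm_group)
  have D: "group ?D" using comm_group_dual[OF field_axioms A G] by (rule comm_group.axioms(2))
  have K: "?O = kernel G ?B (zeta R A G)" by (simp add: O_subgroup_def)
  have units: "subgroup (Units R) (units_of R)"
    using U.subgroup_self by (simp add: units_of_def)
  have B: "?B = dual_group R (Units R) ?D"
    by (simp add: bidual_group_def dual_group_def units_of_def)
  note finD = finite_dual_group[OF A G fin]
  have finB: "finite (carrier ?B)"
    unfolding B by (rule finite_dual_group[OF units D finD])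
  \<comment> \<open>The evaluations at elements of \<open>G\<close> are among the characters of \<open>?D\<close>.\<close>
  have "\<phi> = \<one>\<^bsub>?D\<^esub>" if \<phi>: "\<phi> \<in> O_subgroup R (Units R) ?D" for \<phi>
  proof -
    have "\<phi> g = \<one>" if g: "g \<in> carrier G" for g
    proof -
      have "zeta R A G g \<phi> = \<one>" "\<phi> \<in> carrier ?D"
        using \<phi> Z.hom_closed[OF g] by (auto simp: mem_O_subgroup_iff[OF units D] B)
      then show ?thesis by (simp add: zeta_def)
    qed
    moreover have "\<phi> \<in> carrier ?D"
      using \<phi> by (simp add: mem_O_subgroup_iff[OF units D])
    ultimately show ?thesis
      by (auto simp: dual_group_def hom_group_def units_of_def extensional_def fun_eq_iff)
  qed
  moreover have "\<one>\<^bsub>?D\<^esub> \<in> O_subgroup R (Units R) ?D"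
    unfolding O_subgroup_def
    by (rule subgroup.one_closed[OF group_hom.subgroup_kernel[OF
            zeta_group_hom[OF field_axioms units D]]])
  ultimately have "O_subgroup R (Units R) ?D = {\<one>\<^bsub>?D\<^esub>}" by blast
  then have cardB: "card (carrier ?B) = card (carrier ?D)"
    using card_dual_group[OF char_0 units D finD] by (simp add: B)
  have sub: "subgroup ?O G" unfolding K by (rule Z.subgroup_kernel)
  have "card (rcosets\<^bsub>G\<^esub> ?O) * card ?O = card (carrier ?D) * card ?O"
    using group.lagrange[OF G sub] card_dual_group[OF char_0 A G fin] by (simp add: order_def)
  moreover have "card ?O \<noteq> 0"
    using sub fin subgroup.subset[OF sub] subgroup.one_closed[OF sub]
    by (metis card_0_eq empty_iff finite_subset)
  ultimately have cardQ: "card (carrier (G Mod ?O)) = card (carrier ?B)"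
    using cardB by (simp add: FactGroup_def)
  have zb: "zeta_bar R A G = (\<lambda>C. the_elem (zeta R A G ` C))"
    by (simp add: zeta_bar_def)
  have inj: "inj_on (zeta_bar R A G) (carrier (G Mod ?O))"
    unfolding zb K by (rule Z.FactGroup_inj_on)
  have hom: "zeta_bar R A G \<in> hom (G Mod ?O) ?B"
    unfolding zb K by (rule Z.FactGroup_hom)
  have onto: "zeta_bar R A G ` carrier (G Mod ?O) = carrier ?B"
    using hom inj finB cardQ by (intro card_subset_eq) (auto simp: card_image hom_def)
  show "zeta_bar R A G \<in> iso (G Mod ?O) ?B"
    using hom inj onto by (simp add: iso_def bij_betw_def)
  have "zeta R A G ` carrier G = carrier ?B"
    using onto zeta_bar_coset[OF field_axioms A G]
    by (simp add: carrier_FactGroup image_image cong: image_cong_simp)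
  then show "zeta R A G \<in> epi G ?B"
    by (simp add: epi_def Z.homh)
qed

section \<open>Abelian quotients and their exponents\<close>

lemma (in group) commutator_in_derived:
  assumes "x \<in> carrier G" "y \<in> carrier G"
  shows "x \<otimes> y \<otimes> inv x \<otimes> inv y \<in> derived G (carrier G)"
  unfolding derived_def using assms by (intro generate.incl) blast

lemma (in group) normal_if_derived_subset:
  assumes M: "subgroup M G" and der: "derived G (carrier G) \<subseteq> M"
  shows "M \<lhd> G"
  unfolding normal_inv_iff
proof (intro conjI ballI M)
  fix x h assume x: "x \<in> carrier G" and h: "h \<in> M"
  have hG: "h \<in> carrier G" using M h by (rule subgroup.mem_carrier)
  have "x \<otimes> h \<otimes> inv x \<otimes> inv h \<otimes> h \<in> M"
    using commutator_in_derived[OF x hG] der h M by (blast intro: subgroup.m_closed)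
  then show "x \<otimes> h \<otimes> inv x \<in> M"
    using x hG by (simp add: m_assoc)
qed

lemma (in group) comm_group_Mod_if_derived_subset:
  assumes M: "subgroup M G" and der: "derived G (carrier G) \<subseteq> M"
  shows "comm_group (G Mod M)"
proof -
  interpret M: normal M G by (rule normal_if_derived_subset[OF M der])
  have "M #> x \<otimes> y = M #> y \<otimes> x" if x: "x \<in> carrier G" and y: "y \<in> carrier G" for x y
  proof -
    have "x \<otimes> y \<otimes> inv x \<otimes> inv y = x \<otimes> y \<otimes> inv (y \<otimes> x)"
      using x y by (simp add: inv_mult_group m_assoc)
    then have "x \<otimes> y = x \<otimes> y \<otimes> inv x \<otimes> inv y \<otimes> (y \<otimes> x)"
      using x y m_assoc[of "x \<otimes> y" "inv (y \<otimes> x)" "y \<otimes> x"] by simp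
    moreover have "x \<otimes> y \<otimes> inv x \<otimes> inv y \<in> M"
      using commutator_in_derived[OF x y] der by blast
    ultimately have "x \<otimes> y \<in> M #> (y \<otimes> x)"
      unfolding r_coset_def by blast
    then show ?thesis
      using x y M by (metis m_closed repr_independence)
  qed
  then show ?thesis
    by (intro group.group_comm_groupI M.factorgroup_is_group)
      (auto simp: carrier_FactGroup M.rcos_sum)
qed

lemma (in normal) FactGroup_pow_eq_one_iff:
  assumes x: "x \<in> carrier G"
  shows "(H #> x) [^]\<^bsub>G Mod H\<^esub> (n::nat) = \<one>\<^bsub>G Mod H\<^esub> \<longleftrightarrow> x [^] n \<in> H"
proof -
  have "H #> x [^] n = H \<longleftrightarrow> x [^] n \<in> H"
    using x subgroup_axioms coset_join1[of H "x [^] n"] coset_join2[of "x [^] n" H] by blast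
  then show ?thesis using x by (simp add: FactGroup_pow)
qed

lemma (in group) group_exponent:
  assumes fin: "finite (carrier G)"
  shows "0 < group_exponent G" "x \<in> carrier G \<Longrightarrow> x [^] group_exponent G = \<one>"
proof -
  have "0 < order G \<and> (\<forall>x\<in>carrier G. x [^] order G = \<one>)"
    using fin by (simp add: order_gt_0_iff_finite pow_order_eq_1)
  then have "0 < group_exponent G \<and> (\<forall>x\<in>carrier G. x [^] group_exponent G = \<one>)"
    unfolding group_exponent_def by (rule LeastI)
  then show "0 < group_exponent G" "x \<in> carrier G \<Longrightarrow> x [^] group_exponent G = \<one>"
    by auto
qed

lemma (in normal) exponent_Mod:
  assumes fin: "finite (carrier G)"
  shows "0 < group_exponent (G Mod H)" "x \<in> carrier G \<Longrightarrow> x [^] group_exponent (G Mod H) \<in> H"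
    "\<lbrakk>0 < n; \<And>x. x \<in> carrier G \<Longrightarrow> x [^] n \<in> H\<rbrakk> \<Longrightarrow> group_exponent (G Mod H) \<le> n"
proof -
  have finQ: "finite (carrier (G Mod H))" using fin by (simp add: carrier_FactGroup)
  show "0 < group_exponent (G Mod H)"
    by (rule group.group_exponent(1)[OF factorgroup_is_group finQ])
  show "x [^] group_exponent (G Mod H) \<in> H" if "x \<in> carrier G"
    unfolding FactGroup_pow_eq_one_iff[OF that, symmetric]
    using that by (intro group.group_exponent(2)[OF factorgroup_is_group finQ])
      (simp add: carrier_FactGroup)
  show "group_exponent (G Mod H) \<le> n" if "0 < n" "\<And>x. x \<in> carrier G \<Longrightarrow> x [^] n \<in> H"
    unfolding group_exponent_def
  proof (intro Least_le conjI ballI that(1))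
    fix C assume "C \<in> carrier (G Mod H)"
    then obtain x where x: "x \<in> carrier G" "C = H #> x" by (auto simp: carrier_FactGroup)
    show "C [^]\<^bsub>G Mod H\<^esub> n = \<one>\<^bsub>G Mod H\<^esub>"
      unfolding x(2) FactGroup_pow_eq_one_iff[OF x(1)] by (rule that(2)[OF x(1)])
  qed
qed

section \<open>The minimality property and quotients\<close>

lemma (in field) comm_group_units_subgroup:
  assumes A: "subgroup A (units_of R)"
  shows "comm_group (units_of R\<lparr>carrier := A\<rparr>)"
proof -
  interpret U: comm_group "units_of R" by (rule units_comm_group)
  show ?thesis
    using subgroup.subset[OF A]
    by (intro group.group_comm_groupI U.subgroup_imp_group A) (auto simp: U.m_comm subset_iff)
qed

lemma (in field) restrict_in_dual:
  assumes G: "group G" and f: "f \<in> hom G (units_of R\<lparr>carrier := A\<rparr>)"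
  shows "restrict f (carrier G) \<in> carrier (dual_group R A G)"
proof -
  interpret G: group G by (rule G)
  show ?thesis
    using f by (simp add: dual_group_def hom_group_def hom_def Pi_iff)
qed

text \<open>
  The form in which the extension of characters is used, with the quotient by \<open>M\<close> left implicit. The
  number \<open>e\<close> may be any multiple of the exponent of \<open>G/M\<close>, so that an element that suits \<open>O(G)\<close> also suits
  larger subgroups.
\<close>

lemma (in field) dual_separates_cosets:
  assumes A: "subgroup A (units_of R)" and G: "group G" and fin: "finite (carrier G)"
    and M: "subgroup M G" and der: "derived G (carrier G) \<subseteq> M"
    and a: "a \<in> A" "group.ord (units_of R) a = e" and e: "0 < e"
    and kill: "\<And>x. x \<in> carrier G \<Longrightarrow> x [^]\<^bsub>G\<^esub> e \<in> M"
    and g: "g \<in> carrier G" "g \<notin> M"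
  shows "\<exists>\<phi>\<in>carrier (dual_group R A G). (\<forall>m\<in>M. \<phi> m = \<one>\<^bsub>R\<^esub>) \<and> \<phi> g \<noteq> \<one>\<^bsub>R\<^esub>"
proof -
  interpret G: group G by (rule G)
  interpret U: comm_group "units_of R" by (rule units_comm_group)
  interpret M: normal M G by (rule G.normal_if_derived_subset[OF M der])
  interpret Q: comm_group "G Mod M" by (rule G.comm_group_Mod_if_derived_subset[OF M der])
  let ?C = "generate (units_of R) {a}"
  let ?UC = "units_of R\<lparr>carrier := ?C\<rparr>"
  have aU: "a \<in> carrier (units_of R)" using A a(1) by (rule subgroup.mem_carrier)
  have C: "subgroup ?C (units_of R)" using aU by (intro U.generate_is_subgroup) simp
  have CA: "?C \<subseteq> A" using a(1) A by (intro U.generate_subgroup_incl) auto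
  have UC: "comm_group ?UC" by (rule comm_group_units_subgroup[OF C])
  have powC: "x [^]\<^bsub>?UC\<^esub> n = x [^]\<^bsub>units_of R\<^esub> n" for x and n :: nat
    by (rule U.nat_pow_consistent[symmetric])
  have aC: "a \<in> carrier ?UC" by (simp add: generate.incl)
  have gen: "\<exists>j::nat. u = a [^]\<^bsub>?UC\<^esub> j" if "u \<in> carrier ?UC" for u
    using that e a(2) unfolding powC by (auto simp: U.generate_pow_nat[OF aU])
  have ord: "group.ord ?UC a = e"
    using group.ord_unique[OF comm_group.axioms(2)[OF UC] aC] U.pow_eq_id[OF aU] a(2)
    by (simp add: powC)
  have "x [^]\<^bsub>G Mod M\<^esub> e = \<one>\<^bsub>G Mod M\<^esub>" if x: "x \<in> carrier (G Mod M)" for x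
  proof -
    obtain y where y: "y \<in> carrier G" "x = M #>\<^bsub>G\<^esub> y"
      using x by (auto simp: carrier_FactGroup)
    show ?thesis
      unfolding y(2) M.FactGroup_pow_eq_one_iff[OF y(1)] by (rule kill[OF y(1)])
  qed
  moreover have "M #>\<^bsub>G\<^esub> g \<in> carrier (G Mod M)" "M #>\<^bsub>G\<^esub> g \<noteq> \<one>\<^bsub>G Mod M\<^esub>"
    using g G.coset_join1[OF _ g(1) M] by (auto simp: carrier_FactGroup)
  moreover have "finite (carrier (G Mod M))" using fin by (simp add: carrier_FactGroup)
  ultimately have "\<exists>\<chi>\<in>hom (G Mod M) ?UC. \<chi> (M #>\<^bsub>G\<^esub> g) \<noteq> \<one>\<^bsub>?UC\<^esub>"
    by (intro cyclic_characters_separate_points[OF Q.comm_group_axioms _ UC aC gen ord e])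
  then obtain \<chi> where \<chi>: "\<chi> \<in> hom (G Mod M) ?UC"
    and \<chi>g: "\<chi> (M #>\<^bsub>G\<^esub> g) \<noteq> \<one>\<^bsub>?UC\<^esub>"
    by blast
  have "\<chi> \<in> hom (G Mod M) (units_of R\<lparr>carrier := A\<rparr>)"
    using \<chi> CA by (auto simp: hom_def)
  then have "\<chi> \<circ> (\<lambda>x. M #>\<^bsub>G\<^esub> x) \<in> hom G (units_of R\<lparr>carrier := A\<rparr>)"
    using M.r_coset_hom_Mod by (rule hom_compose[rotated])
  then have dual: "restrict (\<chi> \<circ> (\<lambda>x. M #>\<^bsub>G\<^esub> x)) (carrier G) \<in> carrier (dual_group R A G)"
    by (rule restrict_in_dual[OF G])
  have "\<chi> (M #>\<^bsub>G\<^esub> m) = \<one>\<^bsub>R\<^esub>" if "m \<in> M" for m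
  proof -
    have "\<chi> \<one>\<^bsub>G Mod M\<^esub> = \<one>\<^bsub>?UC\<^esub>"
      using \<chi> Q.is_group comm_group.axioms(2)[OF UC] by (rule hom_one)
    then show ?thesis
      using that M G.coset_join2[of m M] by (simp add: units_of_one subgroup.mem_carrier)
  qed
  then show ?thesis
    using g(1) \<chi>g M.subset by (intro bexI[OF _ dual]) (auto simp: units_of_one subset_iff)
qed

lemma (in field) O_subgroup_subgroup:
  assumes "subgroup A (units_of R)" "group G"
  shows "subgroup (O_subgroup R A G) G"
  unfolding O_subgroup_def
  by (rule group_hom.subgroup_kernel[OF zeta_group_hom[OF field_axioms assms]])

lemma (in field) derived_subset_O_subgroup:
  assumes A: "subgroup A (units_of R)" and G: "group G"
  shows "derived G (carrier G) \<subseteq> O_subgroup R A G"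
proof -
  interpret G: group G by (rule G)
  interpret U: comm_group "units_of R" by (rule units_comm_group)
  have "h \<otimes>\<^bsub>G\<^esub> h' \<otimes>\<^bsub>G\<^esub> inv\<^bsub>G\<^esub> h \<otimes>\<^bsub>G\<^esub> inv\<^bsub>G\<^esub> h' \<in> O_subgroup R A G"
    if h: "h \<in> carrier G" "h' \<in> carrier G" for h h'
  proof -
    have "\<phi> (h \<otimes>\<^bsub>G\<^esub> h' \<otimes>\<^bsub>G\<^esub> inv\<^bsub>G\<^esub> h \<otimes>\<^bsub>G\<^esub> inv\<^bsub>G\<^esub> h') = \<one>"
      if \<phi>: "\<phi> \<in> carrier (dual_group R A G)" for \<phi>
    proof -
      interpret \<phi>: group_hom G "units_of R" \<phi>
        using dual_hom_units[OF A \<phi>] by unfold_locales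
      have "\<phi> (h \<otimes>\<^bsub>G\<^esub> h' \<otimes>\<^bsub>G\<^esub> inv\<^bsub>G\<^esub> h \<otimes>\<^bsub>G\<^esub> inv\<^bsub>G\<^esub> h') = \<one>\<^bsub>units_of R\<^esub>"
        using h by (simp add: U.m_comm[of "\<phi> h"] U.m_assoc)
      then show ?thesis by (simp add: units_of_one)
    qed
    then show ?thesis using h by (simp add: mem_O_subgroup_iff[OF A G])
  qed
  then show ?thesis
    unfolding derived_def
    by (intro G.generate_subgroup_incl O_subgroup_subgroup[OF A G]) auto
qed

text \<open>
  Let \<open>e\<close> be the exponent of \<open>G/O(G)\<close>. Among the elements of \<open>A\<close> whose order divides \<open>e\<close> there is one
  whose order \<open>m\<close> is a multiple of the orders of all the others. Values of characters are such
  elements, so every \<open>m\<close>-th power in \<open>G\<close> lies in \<open>O(G)\<close> and \<open>e \<le> m\<close>.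
\<close>

lemma (in field) exists_ord_exponent_Mod_O_subgroup:
  assumes A: "subgroup A (units_of R)" and G: "group G" and fin: "finite (carrier G)"
  shows "\<exists>a\<in>A. group.ord (units_of R) a = group_exponent (G Mod O_subgroup R A G)"
proof -
  interpret G: group G by (rule G)
  interpret U: comm_group "units_of R" by (rule units_comm_group)
  interpret A: subgroup A "units_of R" by (rule A)
  interpret O: normal "O_subgroup R A G" G
    by (rule G.normal_if_derived_subset[OF O_subgroup_subgroup[OF A G]
          derived_subset_O_subgroup[OF A G]])
  define e where "e = group_exponent (G Mod O_subgroup R A G)"
  note exp = O.exponent_Mod[OF fin, folded e_def]
  define S where "S = {a \<in> A. a [^]\<^bsub>units_of R\<^esub> e = \<one>\<^bsub>units_of R\<^esub>}"
  have S: "subgroup S (units_of R)"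
    by (rule U.subgroupI)
      (auto simp: S_def A.mem_carrier U.nat_pow_inv U.pow_mult_distrib U.m_comm
        intro: exI[of _ "\<one>\<^bsub>units_of R\<^esub>"])
  then obtain a where a: "a \<in> S"
    and kill: "\<And>b. b \<in> S \<Longrightarrow> b [^]\<^bsub>units_of R\<^esub> U.ord a = \<one>\<^bsub>units_of R\<^esub>"
    using U.exists_ord_eq_exponent[OF S exp(1)] by (auto simp: S_def)
  have aU: "a \<in> carrier (units_of R)" using S a by (rule subgroup.mem_carrier)
  have dvd: "U.ord a dvd e" using a aU by (simp add: S_def flip: U.pow_eq_id)
  have "x [^]\<^bsub>G\<^esub> U.ord a \<in> O_subgroup R A G" if x: "x \<in> carrier G" for x
  proof -
    have "\<phi> (x [^]\<^bsub>G\<^esub> U.ord a) = \<one>" if \<phi>: "\<phi> \<in> carrier (dual_group R A G)" for \<phi>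
    proof -
      interpret \<phi>: group_hom G "units_of R" \<phi>
        using dual_hom_units[OF A \<phi>] by unfold_locales
      have "\<phi> x [^]\<^bsub>units_of R\<^esub> e = \<phi> (x [^]\<^bsub>G\<^esub> e)"
        using x by (simp add: \<phi>.hom_nat_pow)
      also have "\<dots> = \<one>\<^bsub>units_of R\<^esub>"
        using exp(2)[OF x] \<phi> by (simp add: mem_O_subgroup_iff[OF A G] units_of_one)
      finally have "\<phi> x \<in> S"
        using dual_value(1)[OF A \<phi> x] by (simp add: S_def)
      then show ?thesis
        using kill[of "\<phi> x"] x by (simp add: \<phi>.hom_nat_pow units_of_one)
    qed
    then show ?thesis using x by (simp add: mem_O_subgroup_iff[OF A G])
  qed
  then have "e \<le> U.ord a"
    using dvd exp(1) by (intro exp(3)) (auto intro: dvd_pos_nat)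
  then have "U.ord a = e"
    using dvd exp(1) by (meson dvd_imp_le le_antisym)
  then show ?thesis using a by (auto simp: S_def e_def)
qed

text \<open>
  A character of \<open>G/N\<close>, pulled back to \<open>G\<close>, is trivial on \<open>O(G)\<close> and on \<open>N\<close>. Conversely an element
  outside \<open>O(G)N\<close> is detected by a character of \<open>G\<close> that is trivial on \<open>O(G)N\<close>, hence on \<open>N\<close>, and so
  descends to \<open>G/N\<close>.
\<close>

lemma (in field) O_subgroup_Mod:
  assumes A: "subgroup A (units_of R)" and G: "group G" and fin: "finite (carrier G)"
    and N: "N \<lhd> G"
  shows "O_subgroup R A (G Mod N) = (\<lambda>y. N #>\<^bsub>G\<^esub> y) ` (O_subgroup R A G <#>\<^bsub>G\<^esub> N)"
proof -
  let ?O = "O_subgroup R A G" and ?P = "O_subgroup R A G <#>\<^bsub>G\<^esub> N"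
  let ?UA = "units_of R\<lparr>carrier := A\<rparr>"
  interpret G: group G by (rule G)
  interpret N: normal N G by (rule N)
  note OG = O_subgroup_subgroup[OF A G] and derO = derived_subset_O_subgroup[OF A G]
  interpret O: normal ?O G by (rule G.normal_if_derived_subset[OF OG derO])
  have Q: "group (G Mod N)" by (rule N.factorgroup_is_group)
  have UA: "group ?UA" using comm_group_units_subgroup[OF A] by (rule comm_group.axioms(2))
  have P: "subgroup ?P G"
    by (rule G.mult_norm_subgroup[OF O.normal_axioms N.subgroup_axioms])
  have memP: "u \<otimes>\<^bsub>G\<^esub> n \<in> ?P" if "u \<in> ?O" "n \<in> N" for u n
    using that by (auto simp: set_mult_def)
  have OP: "?O \<subseteq> ?P"
    using memP[OF _ N.one_closed] O.mem_carrier by (metis G.r_one subsetI)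
  have NP: "N \<subseteq> ?P"
    using memP[OF O.one_closed] N.mem_carrier by (metis G.l_one subsetI)
  show ?thesis
  proof (intro equalityI subsetI)
    fix C assume "C \<in> (\<lambda>y. N #>\<^bsub>G\<^esub> y) ` ?P"
    then obtain y where y: "y \<in> ?P" "C = N #>\<^bsub>G\<^esub> y" by blast
    then obtain u n where un: "u \<in> ?O" "n \<in> N" "y = u \<otimes>\<^bsub>G\<^esub> n"
      by (auto simp: set_mult_def)
    have "\<phi> C = \<one>\<^bsub>R\<^esub>" if \<phi>: "\<phi> \<in> carrier (dual_group R A (G Mod N))" for \<phi>
    proof -
      have "\<phi> \<in> hom (G Mod N) ?UA"
        using \<phi> by (simp add: dual_group_def hom_group_def)
      then have \<psi>: "\<phi> \<circ> (\<lambda>x. N #>\<^bsub>G\<^esub> x) \<in> hom G ?UA"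
        by (rule hom_compose[OF N.r_coset_hom_Mod])
      have "(\<phi> \<circ> (\<lambda>x. N #>\<^bsub>G\<^esub> x)) u = \<one>\<^bsub>R\<^esub>"
        using un(1) restrict_in_dual[OF G \<psi>] by (fastforce simp: mem_O_subgroup_iff[OF A G])
      moreover have "(\<phi> \<circ> (\<lambda>x. N #>\<^bsub>G\<^esub> x)) n = \<one>\<^bsub>R\<^esub>"
        using un(2) hom_one[OF \<open>\<phi> \<in> hom (G Mod N) ?UA\<close> Q UA] G.coset_join2[of n N]
        by (simp add: N.mem_carrier N.subgroup_axioms units_of_one)
      moreover have "\<phi> C = (\<phi> \<circ> (\<lambda>x. N #>\<^bsub>G\<^esub> x)) u \<otimes>\<^bsub>R\<^esub> (\<phi> \<circ> (\<lambda>x. N #>\<^bsub>G\<^esub> x)) n"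
        using hom_mult[OF \<psi>, of u n] un y by (simp add: N.mem_carrier O.mem_carrier units_of_mult)
      ultimately show ?thesis by simp
    qed
    moreover have "C \<in> carrier (G Mod N)"
      using y subgroup.mem_carrier[OF P] by (auto simp: carrier_FactGroup)
    ultimately show "C \<in> O_subgroup R A (G Mod N)"
      by (simp add: mem_O_subgroup_iff[OF A Q])
  next
    fix C assume C: "C \<in> O_subgroup R A (G Mod N)"
    then obtain g where g: "g \<in> carrier G" "C = N #>\<^bsub>G\<^esub> g"
      by (auto simp: mem_O_subgroup_iff[OF A Q] carrier_FactGroup)
    have "g \<in> ?P"
    proof (rule ccontr)
      assume gP: "g \<notin> ?P"
      obtain a where a: "a \<in> A" "group.ord (units_of R) a = group_exponent (G Mod ?O)"
        using exists_ord_exponent_Mod_O_subgroup[OF A G fin] by blast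
      have "derived G (carrier G) \<subseteq> ?P" using derO OP by blast
      then obtain \<phi> where \<phi>: "\<phi> \<in> carrier (dual_group R A G)"
        and \<phi>P: "\<And>p. p \<in> ?P \<Longrightarrow> \<phi> p = \<one>\<^bsub>R\<^esub>" and \<phi>g: "\<phi> g \<noteq> \<one>\<^bsub>R\<^esub>"
        using dual_separates_cosets[OF A G fin P _ a O.exponent_Mod(1)[OF fin] _ g(1) gP]
          O.exponent_Mod(2)[OF fin] OP by blast
      interpret \<phi>: group_hom G ?UA \<phi>
        using \<phi> by (intro group_hom.intro group_hom_axioms.intro G UA)
          (simp add: dual_group_def hom_group_def)
      have "N \<subseteq> kernel G ?UA \<phi>"
        using NP \<phi>P N.subset by (auto simp: kernel_def units_of_one)
      then obtain \<psi> where \<psi>: "\<psi> \<in> hom (G Mod N) ?UA" and \<psi>\<phi>: "\<And>x. x \<in> carrier G \<Longrightarrow> \<psi> (N #>\<^bsub>G\<^esub> x) = \<phi> x"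
        using \<phi>.FactGroup_universal_kernel[OF N] by blast
      have "restrict \<psi> (carrier (G Mod N)) C = \<one>\<^bsub>R\<^esub>" "C \<in> carrier (G Mod N)"
        using C restrict_in_dual[OF Q \<psi>] by (auto simp: mem_O_subgroup_iff[OF A Q])
      then show False using \<psi>\<phi>[OF g(1)] \<phi>g g(2) by simp
    qed
    then show "C \<in> (\<lambda>y. N #>\<^bsub>G\<^esub> y) ` ?P" using g(2) by blast
  qed
qed

theorem proposition10p1:
  fixes K :: "('k, 'r) ring_scheme" and A :: "'k set" and G :: "('a, 'b) monoid_scheme"
  assumes "field K"
    and char_0: "\<And>n::nat. 0 < n \<Longrightarrow> [n] \<cdot>\<^bsub>K\<^esub> \<one>\<^bsub>K\<^esub> \<noteq> \<zero>\<^bsub>K\<^esub>"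
    and "subgroup A (units_of K)"
    and "group G" and "finite (carrier G)"
  shows
    "(zeta K A G \<in> epi G (bidual_group K A G) \<and>
      zeta_bar K A G \<in> iso (G Mod O_subgroup K A G) (bidual_group K A G)) \<and>
     (let S = {M. subgroup M G \<and> derived G (carrier G) \<subseteq> M \<and>
                  (\<exists>a\<in>A. group.ord (units_of K) a = group_exponent (G Mod M))}
      in O_subgroup K A G \<in> S \<and> (\<forall>M\<in>S. O_subgroup K A G \<subseteq> M)) \<and>
     (\<forall>N. N \<lhd> G \<longrightarrow>
        O_subgroup K A (G Mod N) =
          rcosets\<^bsub>G\<lparr>carrier := O_subgroup K A G <#>\<^bsub>G\<^esub> N\<rparr>\<^esub> N)"
proof -
  interpret K: field K by fact
  interpret G: group G by fact
  note A = \<open>subgroup A (units_of K)\<close> and G = \<open>group G\<close> and fin = \<open>finite (carrier G)\<close>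
  have minimal: "O_subgroup K A G \<subseteq> M"
    if M: "subgroup M G" "derived G (carrier G) \<subseteq> M"
      and a: "a \<in> A" "group.ord (units_of K) a = group_exponent (G Mod M)" for M a
  proof
    interpret M: normal M G by (rule G.normal_if_derived_subset[OF M])
    fix g assume g: "g \<in> O_subgroup K A G"
    show "g \<in> M"
    proof (rule ccontr)
      assume "g \<notin> M"
      moreover have "g \<in> carrier G" using g by (simp add: K.mem_O_subgroup_iff[OF A G])
      ultimately have "\<exists>\<phi>\<in>carrier (dual_group K A G). \<phi> g \<noteq> \<one>\<^bsub>K\<^esub>"
        using K.dual_separates_cosets[OF A G fin M a M.exponent_Mod(1)[OF fin]
            M.exponent_Mod(2)[OF fin]] by blast
      then show False using g by (auto simp: K.mem_O_subgroup_iff[OF A G])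
    qed
  qed
  have "O_subgroup K A (G Mod N) = rcosets\<^bsub>G\<lparr>carrier := O_subgroup K A G <#>\<^bsub>G\<^esub> N\<rparr>\<^esub> N" if "N \<lhd> G" for N
    unfolding K.O_subgroup_Mod[OF A G fin that] by (auto simp: RCOSETS_def r_coset_def)
  then show ?thesis
    using K.zeta_bijective[OF char_0 A G fin] minimal
      K.O_subgroup_subgroup[OF A G] K.derived_subset_O_subgroup[OF A G]
      K.exists_ord_exponent_Mod_O_subgroup[OF A G fin]
    unfolding Let_def by blast
qed

end
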